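(* For $n\ge 2$ and $m\ge 3$, $sn(C_{2n}(K_m))=n(m-2)$.
   Context: Graphs are finite, undirected and simple. $C_{2n}(K_m)$ is the graph obtained from a $2n$-cycle $C_{2n}=x_1x_2\cdots x_{2n}x_1$ and $n$ pairwise disjoint copies $K^1,\dots,K^n$ of the complete graph $K_m$ by identifying, for each $1\le i\le n$, the edge $x_{2i-1}x_{2i}$ of the cycle with an edge of $K^i$. (So the graph has $nm$ vertices, and the edges not in any $K^i$ are the alternate edges $x_{2i}x_{2i+1}$, $1\le i\le n$, of the cycle, with $x_{2n+1}=x_1$.) Let $G=(V,E)$ be a connected graph with chromatic number $\chi(G)=k\ge 2$. For $S\subset V$, a partial coloring on $G[S]$ is a proper coloring $\mathscr C_0$ of the induced subgraph $G[S]$ with colors from $\{1,\dots,k\}$ (not all colors need be used). It is a Sudoku coloring of $G$ if there is exactly one proper $k$-coloring $V\to\{1,\dots,k\}$ of $G$ whose restriction to $S$ is $\mathscr C_0$. The Sudoku number $sn(G)$ is the smallest $|S|$ such that $G[S]$ admits a Sudoku coloring of $G$. *)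

theory Defs
  imports "Graph_Theory.Graph_Theory" "HOL-Library.FuncSet"
begin

text \<open>
  A finite simple undirected graph is a finite loop-free symmetric digraph without parallel arcs
  (locale \<^locale>\<open>pair_graph\<close>, or \<^locale>\<open>graph\<close> when arcs are abstract).
\<close>

subsection \<open>Colorings and the Sudoku number\<close>

text \<open>
  Colorings are extensional functions (\<^term>\<open>undefined\<close> off the vertex set), so that
  counting colorings is counting maps on the vertices only.
\<close>

definition proper_coloring :: "('a, 'b) pre_digraph \<Rightarrow> nat \<Rightarrow> ('a \<Rightarrow> nat) \<Rightarrow> bool" where
  "proper_coloring G k c \<longleftrightarrow>
     c \<in> verts G \<rightarrow>\<^sub>E {1..k} \<and> (\<forall>u v. u \<rightarrow>\<^bsub>G\<^esub> v \<longrightarrow> c u \<noteq> c v)"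

definition chromatic_number :: "('a, 'b) pre_digraph \<Rightarrow> nat" where
  "chromatic_number G = (LEAST k. \<exists>c. proper_coloring G k c)"

definition partial_coloring :: "('a, 'b) pre_digraph \<Rightarrow> 'a set \<Rightarrow> ('a \<Rightarrow> nat) \<Rightarrow> bool" where
  "partial_coloring G S c0 \<longleftrightarrow> proper_coloring (G \<restriction> S) (chromatic_number G) c0"

definition sudoku_coloring :: "('a, 'b) pre_digraph \<Rightarrow> 'a set \<Rightarrow> ('a \<Rightarrow> nat) \<Rightarrow> bool" where
  "sudoku_coloring G S c0 \<longleftrightarrow>
     partial_coloring G S c0 \<and>
     (\<exists>!c. proper_coloring G (chromatic_number G) c \<and> restrict c S = c0)"

text \<open>The intended domain is connected finite graphs of chromatic number at least 2.\<close>

definition sudoku_number :: "('a, 'b) pre_digraph \<Rightarrow> nat" where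
  "sudoku_number G =
     (LEAST s. \<exists>S c0. S \<subseteq> verts G \<and> card S = s \<and> sudoku_coloring G S c0)"


subsection \<open>The graph $C_{2n}(K_m)$\<close>

text \<open>
  The \<open>i\<close>-th copy of $K_m$ (indices start at 0) has the vertices \<open>(i, a)\<close> with \<open>a < m\<close>.
  The cycle $x_0 x_1 \cdots x_{2n-1} x_0$ (the usual $x_1 \cdots x_{2n} x_1$ with indices shifted
  by one) meets it in the edge $x_{2i} x_{2i+1}$, which is identified with the edge joining
  \<open>(i, 0)\<close> and \<open>(i, 1)\<close>; since $K_m$ is edge-transitive in both orientations, this choice of
  edge is immaterial up to isomorphism.
\<close>

definition cycle_vertex :: "nat \<Rightarrow> nat \<times> nat" where
  "cycle_vertex j = (j div 2, j mod 2)"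

definition cycle_arcs :: "nat \<Rightarrow> (nat \<times> nat) rel" where
  "cycle_arcs n =
     (let A = {(cycle_vertex j, cycle_vertex (Suc j mod (2 * n))) | j. j < 2 * n} in A \<union> A\<inverse>)"

definition clique_arcs :: "nat \<Rightarrow> nat \<Rightarrow> (nat \<times> nat) rel" where
  "clique_arcs m i = {((i, a), (i, b)) | a b. a < m \<and> b < m \<and> a \<noteq> b}"

definition cycle_of_cliques :: "nat \<Rightarrow> nat \<Rightarrow> (nat \<times> nat) pair_pre_digraph" where
  "cycle_of_cliques n m =
     \<lparr> pverts = {..<n} \<times> {..<m}, parcs = cycle_arcs n \<union> (\<Union>i<n. clique_arcs m i) \<rparr>"

lemma cycle_arcs_cases:
  assumes "(u, v) \<in> cycle_arcs n" "n \<ge> 2"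
  shows "fst u < n \<and> fst v < n \<and> snd u < 2 \<and> snd v < 2 \<and> snd u \<noteq> snd v"
proof -
  have *: "j div 2 < n \<and> Suc j mod (2 * n) div 2 < n \<and> j mod 2 \<noteq> Suc j mod (2 * n) mod 2"
    if j: "j < 2 * n" for j
  proof (cases "Suc j = 2 * n")
    case True
    then have "j mod 2 = 1" by presburger
    moreover have "Suc j mod (2 * n) = 0" using True by simp
    ultimately show ?thesis using j assms(2) by simp
  next
    case False
    then have "Suc j mod (2 * n) = Suc j" "j div 2 < n" "Suc j div 2 < n" using j by auto
    moreover have "j mod 2 \<noteq> Suc j mod 2" by presburger
    ultimately show ?thesis by simp
  qed
  from assms(1) obtain j where j: "j < 2 * n"
    and "(u = cycle_vertex j \<and> v = cycle_vertex (Suc j mod (2 * n))) \<or>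
         (v = cycle_vertex j \<and> u = cycle_vertex (Suc j mod (2 * n)))"
    unfolding cycle_arcs_def Let_def by blast
  then show ?thesis
    unfolding cycle_vertex_def using *[OF j] by (elim disjE conjE) simp_all
qed

lemma cycle_arcs_facts:
  assumes "(u, v) \<in> cycle_arcs n" "n \<ge> 2" "m \<ge> 3"
  shows "u \<in> {..<n} \<times> {..<m}" "v \<in> {..<n} \<times> {..<m}" "snd u \<noteq> snd v"
  using cycle_arcs_cases[OF assms(1,2)] assms(3) by (simp_all add: mem_Times_iff)

lemma pair_graph_cycle_of_cliques:
  assumes "n \<ge> 2" "m \<ge> 3"
  shows "pair_graph (cycle_of_cliques n m)"
proof -
  let ?V = "{..<n} \<times> {..<m}" and ?E = "cycle_arcs n \<union> (\<Union>i<n. clique_arcs m i)"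
  have sub: "?E \<subseteq> ?V \<times> ?V"
    using cycle_arcs_facts[OF _ assms] by (fastforce simp: clique_arcs_def)
  then have fin: "finite ?E" by (rule finite_subset) auto
  have sym: "sym ?E"
    by (auto simp: sym_def cycle_arcs_def clique_arcs_def Let_def)
  have irr: "e \<in> ?E \<Longrightarrow> fst e \<noteq> snd e" for e
    using cycle_arcs_facts(3)[OF _ assms, of "fst e" "snd e"] by (auto simp: clique_arcs_def)
  show ?thesis
    by unfold_locales
      (use sub fin irr sym in \<open>auto simp: cycle_of_cliques_def symmetric_def\<close>)
qed

lemma chromatic_number_cycle_of_cliques:
  assumes "n \<ge> 2" "m \<ge> 3"
  shows "chromatic_number (cycle_of_cliques n m) = m"
  unfolding chromatic_number_def
proof (rule Least_equality)
  let ?c = "restrict (\<lambda>v. Suc (snd v)) ({..<n} \<times> {..<m})"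
  have "proper_coloring (cycle_of_cliques n m) m ?c"
    using cycle_arcs_facts[OF _ assms]
    by (fastforce simp: proper_coloring_def cycle_of_cliques_def clique_arcs_def)
  then show "\<exists>c. proper_coloring (cycle_of_cliques n m) m c" by blast
next
  fix k assume "\<exists>c. proper_coloring (cycle_of_cliques n m) k c"
  then obtain c where c: "proper_coloring (cycle_of_cliques n m) k c" by blast
  have "(\<lambda>a. c (0, a)) ` {..<m} \<subseteq> {1..k}"
    using c assms by (auto simp: proper_coloring_def cycle_of_cliques_def PiE_iff)
  moreover have "inj_on (\<lambda>a. c (0, a)) {..<m}"
  proof (rule inj_onI, rule ccontr)
    fix a b assume ab: "a \<in> {..<m}" "b \<in> {..<m}" "c (0, a) = c (0, b)" "a \<noteq> b"
    then have "((0, a), (0, b)) \<in> parcs (cycle_of_cliques n m)"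
      using assms by (auto simp: cycle_of_cliques_def clique_arcs_def)
    with c ab(3) show False by (auto simp: proper_coloring_def)
  qed
  ultimately show "m \<le> k" using card_inj_on_le[of _ "{..<m}" "{1..k}"] by fastforce
qed

lemma connected_cycle_of_cliques:
  assumes "n \<ge> 2" "m \<ge> 3"
  shows "connected (cycle_of_cliques n m)"
proof -
  let ?G = "cycle_of_cliques n m"
  interpret pair_graph ?G using pair_graph_cycle_of_cliques[OF assms] .
  have arc: "((i, a), (i, b)) \<in> parcs ?G" if "i < n" "a < m" "b < m" "a \<noteq> b" for i a b
    using that by (auto simp: cycle_of_cliques_def clique_arcs_def)
  have inV: "(i, a) \<in> pverts ?G" if "i < n" "a < m" for i a
    using that by (auto simp: cycle_of_cliques_def)
  have clique: "(i, a) \<rightarrow>\<^sup>*\<^bsub>?G\<^esub> (i, b)" if "i < n" "a < m" "b < m" for i a b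
    using that arc[of i a b] inV by (cases "a = b") auto
  have root: "(0, 0) \<rightarrow>\<^sup>*\<^bsub>?G\<^esub> (i, 0)" if "i < n" for i
    using that
  proof (induction i)
    case 0
    then show ?case using inV[of 0 0] assms by auto
  next
    case (Suc i)
    have "(cycle_vertex (2 * i + 1), cycle_vertex (Suc (2 * i + 1) mod (2 * n))) \<in> cycle_arcs n"
      using Suc.prems unfolding cycle_arcs_def Let_def by (intro UnI1 CollectI exI conjI) auto
    moreover have "cycle_vertex (2 * i + 1) = (i, 1)"
      "cycle_vertex (Suc (2 * i + 1) mod (2 * n)) = (Suc i, 0)"
      using Suc.prems by (auto simp: cycle_vertex_def)
    ultimately have "((i, 1), (Suc i, 0)) \<in> parcs ?G" by (auto simp: cycle_of_cliques_def)
    then have "(i, 1) \<rightarrow>\<^sup>*\<^bsub>?G\<^esub> (Suc i, 0)" by auto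
    moreover have "(0, 0) \<rightarrow>\<^sup>*\<^bsub>?G\<^esub> (i, 0)" "(i, 0) \<rightarrow>\<^sup>*\<^bsub>?G\<^esub> (i, 1)"
      using Suc clique[of i 0 1] assms by auto
    ultimately show ?case by (meson reachable_trans)
  qed
  have from0: "(0, 0) \<rightarrow>\<^sup>*\<^bsub>?G\<^esub> v" if "v \<in> pverts ?G" for v
    using that root[of "fst v"] clique[of "fst v" 0 "snd v"] reachable_trans
    by (cases v) (auto simp: cycle_of_cliques_def)
  have reach: "u \<rightarrow>\<^sup>*\<^bsub>?G\<^esub> v" if "u \<in> pverts ?G" "v \<in> pverts ?G" for u v
    using symmetric_reachable[OF pair_sym_arcs from0[OF that(1)]] from0[OF that(2)]
    by (rule reachable_trans)
  moreover have "rtrancl_on (pverts ?G) (parcs ?G) \<subseteq> rtrancl_on (pverts ?G) ((parcs ?G)\<^sup>s)"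
    by (auto simp: symcl_def intro: rtrancl_on_mono[rotated 2])
  ultimately show ?thesis
    using inV[of 0 0] assms unfolding connected_conv reachable_def with_proj_simps
    by fastforce
qed

end

theory Submission
  imports Defs "HOL-Combinatorics.Transposition"
begin

text \<open>
  Lower bound: suppose three vertices of a clique are not precolored. At the two ends of its cycle
  edge the outer neighbors carry colors that occur on one other vertex of the clique each, so that
  at most two of the three transpositions of these vertices conflict with an outer neighbor. The
  remaining transposition turns the coloring into a second extension. Hence every clique has at
  least \<open>m - 2\<close> precolored vertices.

  Upper bound: leave the vertices \<open>(i, 1)\<close> and \<open>(i, 2)\<close> free, and give the outer neighbor of
  \<open>(i, 1)\<close> the color of \<open>(i, 2)\<close>. Then only one of the two colors missing in the clique is
  available for \<open>(i, 1)\<close>, and the other one has to go to \<open>(i, 2)\<close>.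
\<close>

section \<open>Arcs and proper colorings of the cycle of cliques\<close>

lemma proper_coloring_induce_subgraph:
  assumes "proper_coloring G k c" "S \<subseteq> verts G"
  shows "proper_coloring (G \<restriction> S) k (restrict c S)"
proof -
  have "c \<in> S \<rightarrow> {1..k}"
    using assms by (auto simp: proper_coloring_def)
  moreover have "u \<in> S \<and> v \<in> S \<and> u \<rightarrow>\<^bsub>G\<^esub> v" if "u \<rightarrow>\<^bsub>G \<restriction> S\<^esub> v" for u v
    using that by (auto simp: arcs_ends_def arc_to_ends_def induce_subgraph_def)
  ultimately show ?thesis
    using assms(1) by (auto simp: proper_coloring_def)
qed

lemma clique_arc: "i < n \<Longrightarrow> a < m \<Longrightarrow> b < m \<Longrightarrow> a \<noteq> b \<Longrightarrow>
    ((i, a), (i, b)) \<in> parcs (cycle_of_cliques n m)"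
  by (auto simp: cycle_of_cliques_def clique_arcs_def)

text \<open>Translates the wrap-around of the cycle into a wrap-around of the clique index, so that
  the closing edge needs no case of its own.\<close>

lemma cycle_index_link:
  fixes i n :: nat
  shows "Suc (2 * i + 1) mod (2 * n) = 2 * (Suc i mod n)"
  using mult_mod_right[of 2 "Suc i" n] by simp

lemma link_arc:
  assumes "i < n"
  shows "((i, 1), (Suc i mod n, 0)) \<in> parcs (cycle_of_cliques n m)"
proof -
  have "cycle_vertex (2 * i + 1) = (i, 1)"
    "cycle_vertex (Suc (2 * i + 1) mod (2 * n)) = (Suc i mod n, 0)"
    by (simp_all only: cycle_index_link) (simp_all add: cycle_vertex_def)
  moreover have "(cycle_vertex (2 * i + 1), cycle_vertex (Suc (2 * i + 1) mod (2 * n))) \<in> cycle_arcs n"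
    using assms unfolding cycle_arcs_def Let_def by (intro UnI1 CollectI exI conjI) auto
  ultimately show ?thesis
    by (simp add: cycle_of_cliques_def)
qed

lemma cycle_of_cliques_arc_cases:
  assumes "(u, v) \<in> parcs (cycle_of_cliques n m)" "m \<ge> 2"
  obtains (clique) i a b where "i < n" "a < m" "b < m" "a \<noteq> b" "u = (i, a)" "v = (i, b)"
  | (link) i where "i < n" "u = (i, 1)" "v = (Suc i mod n, 0)"
  | (link_rev) i where "i < n" "v = (i, 1)" "u = (Suc i mod n, 0)"
proof -
  have cyc: thesis
    if uv: "(u = cycle_vertex j \<and> v = cycle_vertex (Suc j mod (2 * n))) \<or>
            (v = cycle_vertex j \<and> u = cycle_vertex (Suc j mod (2 * n)))"
      and j: "j < 2 * n" for j
  proof (cases "even j")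
    \<comment> \<open>Cycle edges that start at an even index lie inside a clique; those that start
      at an odd index are the links between cliques.\<close>
    case True
    then obtain i where i: "j = 2 * i" by (elim evenE)
    then have "cycle_vertex j = (i, 0)" "cycle_vertex (Suc j mod (2 * n)) = (i, 1)" "i < n"
      using j by (auto simp: cycle_vertex_def)
    then show thesis
      using uv clique[of i 0 1] clique[of i 1 0] assms(2) by auto
  next
    case False
    then obtain i where i: "j = 2 * i + 1" by (elim oddE)
    have "Suc j mod (2 * n) = 2 * (Suc i mod n)"
      unfolding i by (rule cycle_index_link)
    then have "cycle_vertex j = (i, 1)" "cycle_vertex (Suc j mod (2 * n)) = (Suc i mod n, 0)" "i < n"
      using j i by (auto simp: cycle_vertex_def)
    then show thesis
      using uv link link_rev by auto
  qed
  show thesis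
    using assms(1) cyc clique
    unfolding cycle_of_cliques_def clique_arcs_def cycle_arcs_def Let_def
    by auto
qed

text \<open>Being injective on a clique is being proper there. Since \<noteq> is symmetric, one
  condition per link covers both of its arcs. Both bounds argue from this form.\<close>

lemma proper_coloring_cycle_of_cliques_iff:
  assumes "m \<ge> 2"
  shows "proper_coloring (cycle_of_cliques n m) k c \<longleftrightarrow>
    c \<in> {..<n} \<times> {..<m} \<rightarrow>\<^sub>E {1..k} \<and>
    (\<forall>i<n. inj_on (\<lambda>a. c (i, a)) {..<m}) \<and> (\<forall>i<n. c (i, 1) \<noteq> c (Suc i mod n, 0))"
    (is "?P \<longleftrightarrow> ?V \<and> ?I \<and> ?L")
proof -
  have verts: "pverts (cycle_of_cliques n m) = {..<n} \<times> {..<m}"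
    by (simp add: cycle_of_cliques_def)
  let ?A = "\<forall>u v. (u, v) \<in> parcs (cycle_of_cliques n m) \<longrightarrow> c u \<noteq> c v"
  have "?A \<longleftrightarrow> ?I \<and> ?L"
  proof (intro iffI conjI allI impI)
    fix u v assume *: "?I \<and> ?L" and "(u, v) \<in> parcs (cycle_of_cliques n m)"
    from this(2) assms show "c u \<noteq> c v"
      by (cases rule: cycle_of_cliques_arc_cases) (use * in \<open>fastforce simp: inj_on_def\<close>)+
  next
    fix i assume A: "?A" "i < n"
    then show "inj_on (\<lambda>a. c (i, a)) {..<m}"
      using clique_arc[of i n] by (fastforce intro!: inj_onI)
    show "c (i, 1) \<noteq> c (Suc i mod n, 0)"
      using A link_arc by blast
  qed
  then show ?thesis
    by (simp add: proper_coloring_def verts)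
qed

section \<open>Lower bound: transpositions within a clique\<close>

lemma Suc_mod_neq:
  fixes i n :: nat
  assumes "i < n" "n \<ge> 2"
  shows "Suc i mod n \<noteq> i"
  using assms by (cases "Suc i = n") auto

text \<open>Permuting a clique keeps its colors distinct, and only two links touch clique
  \<open>i\<close>: the outgoing one at \<open>(i, 1)\<close>, checked by \<open>R\<close>, and the
  incoming one at \<open>(i, 0)\<close>, checked by \<open>L\<close>.\<close>

lemma proper_coloring_transpose:
  assumes "n \<ge> 2" "m \<ge> 2" "proper_coloring (cycle_of_cliques n m) k c"
    and "j < n" "i = Suc j mod n" "p < m" "q < m"
    and R: "c (i, transpose p q 1) \<noteq> c (Suc i mod n, 0)"
    and L: "c (j, 1) \<noteq> c (i, transpose p q 0)"
  shows "proper_coloring (cycle_of_cliques n m) k (c \<circ> transpose (i, p) (i, q))"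
proof -
  let ?d = "c \<circ> transpose (i, p) (i, q)"
  have i: "i < n" using assms by simp
  have c: "c \<in> {..<n} \<times> {..<m} \<rightarrow>\<^sub>E {1..k}"
    "\<And>h. h < n \<Longrightarrow> inj_on (\<lambda>a. c (h, a)) {..<m}"
    "\<And>h. h < n \<Longrightarrow> c (h, 1) \<noteq> c (Suc h mod n, 0)"
    using assms(3) by (auto simp: proper_coloring_cycle_of_cliques_iff[OF assms(2)])
  have d: "?d (h, a) = (if h = i then c (i, transpose p q a) else c (h, a))" for h a
    by (auto simp: transpose_def)
  have "?d \<in> {..<n} \<times> {..<m} \<rightarrow>\<^sub>E {1..k}"
    using c(1) i assms(6,7) by (auto simp: PiE_iff extensional_def transpose_def)
  moreover have "inj_on (\<lambda>a. ?d (h, a)) {..<m}" if "h < n" for h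
  proof (cases "h = i")
    case True
    have "transpose p q ` {..<m} = {..<m}"
      using assms(6,7) by (intro transpose_image_eq) auto
    then have "inj_on ((\<lambda>a. c (i, a)) \<circ> transpose p q) {..<m}"
      using c(2)[OF i] by (intro comp_inj_on) auto
    then show ?thesis unfolding d using True by (simp add: comp_def)
  next
    case False
    then show ?thesis unfolding d using c(2)[OF that] by simp
  qed
  moreover have "?d (h, 1) \<noteq> ?d (Suc h mod n, 0)" if h: "h < n" for h
  proof (cases "h = i")
    case True
    then show ?thesis unfolding d using R Suc_mod_neq[OF i assms(1)] by simp
  next
    case False
    \<comment> \<open>The cyclic successor is injective, so the link into clique \<open>i\<close>
      comes from \<open>j\<close> alone.\<close>
    have "h = j" if "Suc h mod n = i"
      using that h assms(4,5) by (auto simp: mod_Suc split: if_splits)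
    then show ?thesis unfolding d using False L c(3)[OF h] by auto
  qed
  ultimately show ?thesis
    by (simp add: proper_coloring_cycle_of_cliques_iff[OF assms(2)])
qed

text \<open>Here \<open>f\<close> is the coloring of one clique, and \<open>R\<close> and
  \<open>L\<close> are the colors of the outer neighbors of its vertices 1 and 0. Each of them rules
  out at most one of the three pairs.\<close>

lemma compatible_transposition_exists:
  fixes f :: "nat \<Rightarrow> nat"
  assumes "inj_on f A" "{0, 1} \<subseteq> A" "{p, q, r} \<subseteq> A" "p \<noteq> q" "p \<noteq> r" "q \<noteq> r"
    and "f 1 \<noteq> R" "f 0 \<noteq> L"
  obtains x y where "x \<in> {p, q, r}" "y \<in> {p, q, r}" "x \<noteq> y"
    "f (transpose x y 1) \<noteq> R" "f (transpose x y 0) \<noteq> L"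
proof -
  have inj: "f x = f y \<Longrightarrow> x = y" if "x \<in> {0, 1, p, q, r}" "y \<in> {0, 1, p, q, r}" for x y
    using assms(1-3) that by (auto dest: inj_onD)
  \<comment> \<open>As \<open>f 1\<close> differs from \<open>R\<close>, a conflict means that 1 is
    moved, and by injectivity its partner is the only vertex of color \<open>R\<close>.\<close>
  have R: "{x, y} = {1, z}"
    if "f (transpose x y 1) = R" "f z = R" "x \<in> {p, q, r}" "y \<in> {p, q, r}" "z \<in> {p, q, r}" for x y z
    using that assms(7) inj[of x z] inj[of y z] by (auto simp: transpose_def split: if_splits)
  have L: "{x, y} = {0, z}"
    if "f (transpose x y 0) = L" "f z = L" "x \<in> {p, q, r}" "y \<in> {p, q, r}" "z \<in> {p, q, r}" for x y z
    using that assms(8) inj[of x z] inj[of y z] by (auto simp: transpose_def split: if_splits)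
  have R': "{x, y} = {x', y'}"
    if "f (transpose x y 1) = R" "f (transpose x' y' 1) = R"
      "x \<in> {p, q, r}" "y \<in> {p, q, r}" "x' \<in> {p, q, r}" "y' \<in> {p, q, r}" for x y x' y'
    using that R[of x y x'] R[of x y y'] assms(7)
    by (auto simp: transpose_def doubleton_eq_iff split: if_splits)
  have L': "{x, y} = {x', y'}"
    if "f (transpose x y 0) = L" "f (transpose x' y' 0) = L"
      "x \<in> {p, q, r}" "y \<in> {p, q, r}" "x' \<in> {p, q, r}" "y' \<in> {p, q, r}" for x y x' y'
    using that L[of x y x'] L[of x y y'] assms(8)
    by (auto simp: transpose_def doubleton_eq_iff split: if_splits)
  have ne: "{p, q} \<noteq> {p, r}" "{p, q} \<noteq> {q, r}" "{p, r} \<noteq> {q, r}"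
    using assms(4-6) by (auto simp: doubleton_eq_iff)
  \<comment> \<open>Three distinct pairs, at most one conflict at each of the two ends: some pair is
    left.\<close>
  show thesis
    using that[of p q] that[of p r] that[of q r] assms(4-6) ne
      R'[of p q p r] R'[of p q q r] R'[of p r q r] L'[of p q p r] L'[of p q q r] L'[of p r q r]
    by blast
qed

lemma card_uncolored_le_2:
  assumes "n \<ge> 2" "m \<ge> 3" "sudoku_coloring (cycle_of_cliques n m) S c0" "i < n"
  shows "card {a. a < m \<and> (i, a) \<notin> S} \<le> 2"
proof (rule ccontr)
  assume "\<not> ?thesis"
  then have "3 \<le> card {a. a < m \<and> (i, a) \<notin> S}" by simp
  then obtain T where "T \<subseteq> {a. a < m \<and> (i, a) \<notin> S}" "card T = 3"
    by (elim obtain_subset_with_card_n)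
  then obtain p q r where pqr: "{p, q, r} \<subseteq> {a. a < m \<and> (i, a) \<notin> S}"
    "p \<noteq> q" "p \<noteq> r" "q \<noteq> r"
    by (auto simp: card_3_iff)
  have m: "m \<ge> 2" using assms(2) by simp
  let ?proper = "proper_coloring (cycle_of_cliques n m) m"
  have "\<exists>!c. ?proper c \<and> restrict c S = c0"
    using assms(3) chromatic_number_cycle_of_cliques[OF assms(1,2)]
    by (simp add: sudoku_coloring_def)
  then obtain c where c: "?proper c" "restrict c S = c0"
    and unique: "\<And>d. ?proper d \<Longrightarrow> restrict d S = c0 \<Longrightarrow> d = c"
    by blast
  \<comment> \<open>The cyclic predecessor of \<open>i\<close>, whose vertex \<open>(j, 1)\<close>
    is the outer neighbor of \<open>(i, 0)\<close>.\<close>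
  define j where "j = (if i = 0 then n - 1 else i - 1)"
  have j: "j < n" "i = Suc j mod n"
    using assms(1,4) by (auto simp: j_def)
  have inj: "inj_on (\<lambda>a. c (i, a)) {..<m}"
    and R: "c (i, 1) \<noteq> c (Suc i mod n, 0)" and L: "c (i, 0) \<noteq> c (j, 1)"
    using c(1) assms(4) j by (auto simp: proper_coloring_cycle_of_cliques_iff[OF m])
  obtain x y where xy: "x \<in> {p, q, r}" "y \<in> {p, q, r}" "x \<noteq> y"
    "c (i, transpose x y 1) \<noteq> c (Suc i mod n, 0)" "c (i, transpose x y 0) \<noteq> c (j, 1)"
    using compatible_transposition_exists[OF inj _ _ pqr(2-4) R L] pqr(1) assms(2) by auto
  have xy': "x < m" "y < m" "(i, x) \<notin> S" "(i, y) \<notin> S"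
    using pqr(1) xy(1,2) by auto
  let ?d = "c \<circ> transpose (i, x) (i, y)"
  have "?proper ?d"
    using proper_coloring_transpose[OF assms(1) m c(1) j xy'(1,2) xy(4)] xy(5) by simp
  \<comment> \<open>Both swapped vertices lie outside \<open>S\<close>, so the precolored part is
    unchanged.\<close>
  moreover have "restrict ?d S = c0"
    unfolding c(2)[symmetric] using xy' by (intro restrict_ext) (auto simp: transpose_def)
  ultimately have "?d = c" by (rule unique)
  then have "c (i, x) = c (i, y)" by (metis comp_apply transpose_apply_first)
  then show False using inj_onD[OF inj] xy(3) xy' by auto
qed

lemma card_sudoku_coloring_ge:
  assumes "n \<ge> 2" "m \<ge> 3" "S \<subseteq> {..<n} \<times> {..<m}"
    "sudoku_coloring (cycle_of_cliques n m) S c0"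
  shows "n * (m - 2) \<le> card S"
proof -
  \<comment> \<open>Slicing \<open>S\<close> by cliques makes its size a sum of \<open>n\<close>
    terms, each at least \<open>m - 2\<close>.\<close>
  have S: "S = (SIGMA i:{..<n}. {a. a < m \<and> (i, a) \<in> S})"
    using assms(3) by auto
  have "m - 2 \<le> card {a. a < m \<and> (i, a) \<in> S}" if "i < n" for i
  proof -
    have "{a. a < m \<and> (i, a) \<in> S} = {..<m} - {a. a < m \<and> (i, a) \<notin> S}" by auto
    then have "card {a. a < m \<and> (i, a) \<in> S} = m - card {a. a < m \<and> (i, a) \<notin> S}"
      by (simp add: card_Diff_subset subset_eq)
    then show ?thesis
      using card_uncolored_le_2[OF assms(1,2,4) that] by simp
  qed
  then have "n * (m - 2) \<le> (\<Sum>i<n. card {a. a < m \<and> (i, a) \<in> S})"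
    using sum_bounded_below[of "{..<n}" "m - 2"] by simp
  also have "\<dots> = card S"
    by (subst (2) S) (simp add: card_SigmaI)
  finally show ?thesis .
qed

section \<open>Upper bound: an explicit Sudoku coloring\<close>

text \<open>The colors of the vertices \<open>(i, 0)\<close>: 1 and 2 alternate, and 3 at index 0
  lets cyclically consecutive colors differ for odd \<open>n\<close> as well.\<close>

definition link_color :: "nat \<Rightarrow> nat" where
  "link_color i = (if i = 0 then 3 else Suc (i mod 2))"

lemma link_color_bounds: "link_color i \<in> {1, 2, 3}"
  by (auto simp: link_color_def)

lemma link_color_Suc_mod_neq:
  assumes "i < n" "n \<ge> 2"
  shows "link_color (Suc i mod n) \<noteq> link_color i"
proof (cases "Suc i = n")
  case True
  then show ?thesis using assms by (auto simp: link_color_def)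
next
  case False
  then have "Suc i mod n = Suc i" using assms by simp
  then show ?thesis by (simp add: link_color_def mod_Suc)
qed

text \<open>Since the colors 1, 2, 3 add up to 6, the vertex \<open>(i, 1)\<close> gets the third of them.\<close>

definition witness_coloring :: "nat \<Rightarrow> nat \<times> nat \<Rightarrow> nat" where
  "witness_coloring n = (\<lambda>(i, a).
     let f = link_color i; g = link_color (Suc i mod n)
     in if a = 0 then f else if a = 1 then 6 - f - g else if a = 2 then g else Suc a)"

lemma proper_witness_coloring:
  assumes "n \<ge> 2" "m \<ge> 3"
  shows "proper_coloring (cycle_of_cliques n m) m
           (restrict (witness_coloring n) ({..<n} \<times> {..<m}))"
proof -
  have m: "m \<ge> 2" using assms(2) by simp
  have col: "link_color i \<in> {1, 2, 3}" "link_color (Suc i mod n) \<in> {1, 2, 3}"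
    "link_color (Suc i mod n) \<noteq> link_color i" if "i < n" for i
    using link_color_bounds link_color_Suc_mod_neq[OF that assms(1)] by auto
  have "witness_coloring n (i, a) \<in> {1..m}" if "i < n" "a < m" for i a
    using col[OF that(1)] that assms(2) by (auto simp: witness_coloring_def Let_def)
  \<comment> \<open>The vertices 0, 1, 2 share the colors 1, 2, 3; every other vertex has a color of
    at least 4.\<close>
  moreover have "inj_on (\<lambda>a. witness_coloring n (i, a)) {..<m}" if "i < n" for i
    using col[OF that] by (auto simp: witness_coloring_def Let_def inj_on_def split: if_splits)
  moreover have "witness_coloring n (i, 1) \<noteq> witness_coloring n (Suc i mod n, 0)" if "i < n" for i
    using col[OF that] by (auto simp: witness_coloring_def Let_def)
  ultimately show ?thesis
    using assms by (auto simp: proper_coloring_cycle_of_cliques_iff[OF m] inj_on_def)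
qed

lemma sudoku_witness_coloring:
  assumes "n \<ge> 2" "m \<ge> 3"
  defines "S \<equiv> {..<n} \<times> ({..<m} - {1, 2})"
  shows "sudoku_coloring (cycle_of_cliques n m) S (restrict (witness_coloring n) S)"
proof -
  let ?G = "cycle_of_cliques n m"
  let ?V = "{..<n} \<times> {..<m}"
  define w where "w = restrict (witness_coloring n) ?V"
  have m: "m \<ge> 2" using assms(2) by simp
  have SV: "S \<subseteq> ?V" by (auto simp: S_def)
  have wS: "restrict w S = restrict (witness_coloring n) S"
    using SV by (auto simp: w_def Int_absorb1)
  note iff = proper_coloring_cycle_of_cliques_iff[OF m]
  have w: "proper_coloring ?G m w"
    unfolding w_def by (rule proper_witness_coloring[OF assms(1,2)])
  have partial: "proper_coloring (with_proj ?G \<restriction> S) m (restrict w S)"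
    by (rule proper_coloring_induce_subgraph[OF w])
      (use SV in \<open>simp add: cycle_of_cliques_def\<close>)
  have "c = w" if c: "proper_coloring ?G m c" and cS: "restrict c S = restrict w S" for c
  \<comment> \<open>Off the vertex set both colorings are \<open>undefined\<close>, so agreement on
    \<open>?V\<close> suffices.\<close>
  proof (rule extensionalityI[of _ ?V])
    show "c \<in> extensional ?V" "w \<in> extensional ?V"
      using c w by (auto simp: iff PiE_iff)
  next
    have eqS: "c v = w v" if "v \<in> S" for v
      using cS that by (metis restrict_apply')
    fix v assume "v \<in> ?V"
    then obtain i a where v: "v = (i, a)" and i: "i < n" and a: "a < m" by auto
    have injc: "inj_on (\<lambda>a. c (i, a)) {..<m}" using c i by (simp add: iff)
    have "inj_on (\<lambda>a. w (i, a)) {..<m}" "(\<lambda>a. w (i, a)) ` {..<m} \<subseteq> {1..m}"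
      using w i by (auto simp: iff PiE_iff)
    \<comment> \<open>A clique on \<open>m\<close> vertices uses all \<open>m\<close> colors, so any
      color of \<open>c\<close> occurs under \<open>w\<close> in the same clique.\<close>
    then have surj: "(\<lambda>a. w (i, a)) ` {..<m} = {1..m}"
      by (intro card_subset_eq) (auto simp: card_image)
    have cases12: "c (i, b) \<in> {w (i, 1), w (i, 2)}" if b: "b \<in> {1, 2}" for b
    proof -
      have "b < m" using b assms(2) by auto
      then have "c (i, b) \<in> {1..m}" using c i by (auto simp: iff PiE_iff)
      then obtain b' where b': "b' < m" "c (i, b) = w (i, b')"
        using surj by blast
      have "b' \<in> {1, 2}"
      proof (rule ccontr)
        assume "b' \<notin> {1, 2}"
        then have "(i, b') \<in> S" "b \<noteq> b'" using b' i b by (auto simp: S_def)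
        then show False
          using inj_onD[OF injc, of b b'] eqS[of "(i, b')"] b' \<open>b < m\<close> by auto
      qed
      with b' show ?thesis by auto
    qed
    \<comment> \<open>The precolored outer neighbor of \<open>(i, 1)\<close> has the color
      \<open>link_color (Suc i mod n)\<close>, just as \<open>(i, 2)\<close> does under
      \<open>w\<close>; this decides between the two candidates.\<close>
    have "Suc i mod n < n" using i by simp
    then have "(Suc i mod n, 0) \<in> S" "w (Suc i mod n, 0) = w (i, 2)"
      using i assms(2) by (auto simp: S_def w_def witness_coloring_def Let_def)
    moreover have "c (i, 1) \<noteq> c (Suc i mod n, 0)" using c i by (simp add: iff)
    ultimately have "c (i, 1) \<noteq> w (i, 2)" using eqS by simp
    then have 1: "c (i, 1) = w (i, 1)" using cases12[of 1] by auto
    moreover have "c (i, 1) \<noteq> c (i, 2)" using inj_onD[OF injc, of 1 2] assms(2) by auto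
    ultimately have 2: "c (i, 2) = w (i, 2)" using cases12[of 2] by auto
    show "c v = w v"
      using 1 2 eqS[of v] i a unfolding v S_def by (cases "a \<in> {1, 2}") auto
  qed
  then show ?thesis
    unfolding sudoku_coloring_def partial_coloring_def
      chromatic_number_cycle_of_cliques[OF assms(1,2)]
    using w partial wS by metis
qed

theorem theorem3p10:
  fixes n m :: nat
  assumes "n \<ge> 2" and "m \<ge> 3"
  shows "sudoku_number (cycle_of_cliques n m) = n * (m - 2)"
  unfolding sudoku_number_def
proof (rule Least_equality)
  let ?S = "{..<n} \<times> ({..<m} - {1, 2})"
  have "card ?S = n * (m - 2)"
    using assms(2) by (simp add: card_cartesian_product card_Diff_subset numeral_2_eq_2)
  moreover have "?S \<subseteq> pverts (cycle_of_cliques n m)"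
    by (auto simp: cycle_of_cliques_def)
  ultimately show "\<exists>S c0. S \<subseteq> verts (cycle_of_cliques n m) \<and> card S = n * (m - 2) \<and>
      sudoku_coloring (cycle_of_cliques n m) S c0"
    using sudoku_witness_coloring[OF assms] by auto
next
  fix s
  assume "\<exists>S c0. S \<subseteq> verts (cycle_of_cliques n m) \<and> card S = s \<and>
      sudoku_coloring (cycle_of_cliques n m) S c0"
  then show "n * (m - 2) \<le> s"
    using card_sudoku_coloring_ge[OF assms] by (auto simp: cycle_of_cliques_def)
qed

end
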